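(* Let $\mathbb{F}$ be an algebraically closed field of characteristic $p>3$ and let $n\in\mathbb{N}$. Given a non-zero $q\in\mathcal{W}(1;n)$, set $m=\nu(q)+1$. Then $$\mathcal{W}_n(q)\cong\mathcal{W}_n\!\left(e_{\nu(q)}+\sum_{i\in E_m}a_i e_{\nu(q)+i}\right)$$ for certain scalars $a_i\in\mathbb{F}$ with $i\in E_m$.
   Context: For $n\geq 1$, the divided powers algebra $\mathcal{O}(1;n)$ over $\mathbb{F}$ is the commutative associative unital algebra with basis $x^{(i)}$, $0\le i<p^n$, and multiplication $x^{(i)}x^{(j)}=\binom{i+j}{j}x^{(i+j)}$ with $x^{(k)}=0$ for $k\geq p^n$. Let $\partial$ be its derivation with $\partial(x^{(i)})=x^{(i-1)}$ ($\partial(x^{(0)})=0$). The Zassenhaus algebra is $\mathcal{W}(1;n)=\mathcal{O}(1;n)\partial$ with Lie bracket $[f\partial,g\partial]=(f\,\partial(g)-\partial(f)\,g)\partial$ and basis $e_i=x^{(i+1)}\partial$, $-1\le i\le p^n-2$. Let $\bullet$ be the commutative associative product on $\mathcal{W}(1;n)$ given by $(f\partial)\bullet(g\partial)=(fg)\partial$. For $q\in\mathcal{W}(1;n)$, $\mathcal{W}_n(q)$ is the vector space $\mathcal{W}(1;n)$ with its Lie bracket and the associative commutative product $x\bullet_q y=x\bullet q\bullet y$. Isomorphism ($\cong$) means a linear bijection preserving both multiplications. For non-zero $q=\sum_{i=-1}^{p^n-2}q_ie_i$, put $\nu(q)=\min\{i: q_i\neq 0\}$. For $0\le m\le p^n-1$,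 put $$E_m=\left\{s>0 \text{ with } m+s\le p^n-1:\ s=p^j-1 \text{ for some } j,\ \text{or } \binom{m+s+1}{m}\equiv 0 \pmod p\right\}.$$ *)

theory Defs
  imports
    "HOL-Library.Function_Algebras"
    "HOL-Computational_Algebra.Computational_Algebra"
    "HOL-Number_Theory.Cong"
begin

text \<open>
  An element of the divided powers algebra is represented by its coordinates:
  \<open>f :: nat \<Rightarrow> 'a\<close> stands for the sum of the \<open>f i x\<^sup>(\<^sup>i\<^sup>)\<close> over \<open>i < p ^ n\<close>, where \<open>p = CHAR('a)\<close>.
  Addition, subtraction and sums are pointwise (\<open>Function_Algebras\<close>); the pointwise
  product of that theory is never used.
\<close>

definition dp_scale :: "'a::field \<Rightarrow> (nat \<Rightarrow> 'a) \<Rightarrow> nat \<Rightarrow> 'a" (infixr "*\<^sub>d" 75)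
  where "c *\<^sub>d f = (\<lambda>k. c * f k)"

definition dp_space :: "nat \<Rightarrow> (nat \<Rightarrow> 'a::field) set"
  where "dp_space n = {f. \<forall>i \<ge> CHAR('a) ^ n. f i = 0}"

definition dp_basis :: "nat \<Rightarrow> nat \<Rightarrow> nat \<Rightarrow> 'a::field"
  where "dp_basis n i = (\<lambda>k. if k = i \<and> i < CHAR('a) ^ n then 1 else 0)"

text \<open>Bilinear extension of the multiplication rule for basis elements.\<close>

definition dp_mult :: "nat \<Rightarrow> (nat \<Rightarrow> 'a::field) \<Rightarrow> (nat \<Rightarrow> 'a) \<Rightarrow> nat \<Rightarrow> 'a"
  where "dp_mult n f g =
    (\<Sum>i < CHAR('a) ^ n. \<Sum>j < CHAR('a) ^ n.
      (f i * g j * of_nat ((i + j) choose j)) *\<^sub>d dp_basis n (i + j))"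

definition dp_deriv :: "(nat \<Rightarrow> 'a::field) \<Rightarrow> nat \<Rightarrow> 'a"
  where "dp_deriv f = (\<lambda>k. f (Suc k))"

text \<open>
  The Zassenhaus algebra is free of rank one over the divided powers algebra with generator
  \<open>\<partial>\<close>, so \<open>f \<partial>\<close> is represented by \<open>f\<close> itself, and its underlying space is \<open>dp_space n\<close>.
  The product \<open>(f \<partial>) \<bullet> (g \<partial>) = (f g) \<partial>\<close> then is \<open>dp_mult n\<close>. Indices of the basis \<open>e\<^sub>i\<close>
  are integers because they start at \<open>-1\<close>.
\<close>

definition zass_bracket :: "nat \<Rightarrow> (nat \<Rightarrow> 'a::field) \<Rightarrow> (nat \<Rightarrow> 'a) \<Rightarrow> nat \<Rightarrow> 'a"
  where "zass_bracket n f g = dp_mult n f (dp_deriv g) - dp_mult n (dp_deriv f) g"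

definition zass_e :: "nat \<Rightarrow> int \<Rightarrow> nat \<Rightarrow> 'a::field"
  where "zass_e n i = dp_basis n (nat (i + 1))"

definition zass_coeff :: "(nat \<Rightarrow> 'a::field) \<Rightarrow> int \<Rightarrow> 'a"
  where "zass_coeff q i = q (nat (i + 1))"

definition zass_nu :: "nat \<Rightarrow> (nat \<Rightarrow> 'a::field) \<Rightarrow> int"
  where "zass_nu n q = Min {i \<in> {-1 .. int (CHAR('a) ^ n) - 2}. zass_coeff q i \<noteq> 0}"

record 'a two_product_algebra =
  space :: "(nat \<Rightarrow> 'a) set"
  bracket :: "(nat \<Rightarrow> 'a) \<Rightarrow> (nat \<Rightarrow> 'a) \<Rightarrow> nat \<Rightarrow> 'a"
  product :: "(nat \<Rightarrow> 'a) \<Rightarrow> (nat \<Rightarrow> 'a) \<Rightarrow> nat \<Rightarrow> 'a"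

definition zass_alg :: "nat \<Rightarrow> (nat \<Rightarrow> 'a::field) \<Rightarrow> 'a two_product_algebra"
  where "zass_alg n q =
    \<lparr> space = dp_space n,
      bracket = zass_bracket n,
      product = (\<lambda>x y. dp_mult n (dp_mult n x q) y) \<rparr>"

definition alg_isomorphic ::
  "'a::field two_product_algebra \<Rightarrow> 'a two_product_algebra \<Rightarrow> bool" (infix "\<cong>\<^sub>2" 50)
  where "A \<cong>\<^sub>2 B \<longleftrightarrow>
    (\<exists>\<phi>. bij_betw \<phi> (space A) (space B) \<and>
      (\<forall>x \<in> space A. \<forall>y \<in> space A. \<phi> (x + y) = \<phi> x + \<phi> y) \<and>
      (\<forall>c. \<forall>x \<in> space A. \<phi> (c *\<^sub>d x) = c *\<^sub>d \<phi> x) \<and>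
      (\<forall>x \<in> space A. \<forall>y \<in> space A. \<phi> (bracket A x y) = bracket B (\<phi> x) (\<phi> y)) \<and>
      (\<forall>x \<in> space A. \<forall>y \<in> space A. \<phi> (product A x y) = product B (\<phi> x) (\<phi> y)))"

definition exc_set :: "nat \<Rightarrow> nat \<Rightarrow> nat \<Rightarrow> nat set"
  where "exc_set p n m =
    {s. s > 0 \<and> m + s \<le> p ^ n - 1 \<and>
        ((\<exists>j. s = p ^ j - 1) \<or> [(m + s + 1) choose m = 0] (mod p))}"

lemma sum_fun_apply: "(\<Sum>i\<in>A. F i) k = (\<Sum>i\<in>A. F i k)"
  for F :: "'b \<Rightarrow> nat \<Rightarrow> 'a::comm_monoid_add"
  by (induction A rule: infinite_finite_induct) auto

lemma dp_mult_basis: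
  assumes "i < CHAR('a) ^ n" "j < CHAR('a) ^ n"
  shows "dp_mult n (dp_basis n i) (dp_basis n j :: nat \<Rightarrow> 'a::field) =
    of_nat ((i + j) choose j) *\<^sub>d dp_basis n (i + j)"
proof
  fix k
  let ?N = "CHAR('a) ^ n"
  have "dp_mult n (dp_basis n i) (dp_basis n j) k =
    (\<Sum>a<?N. \<Sum>b<?N. if b = j then (if a = i then
       of_nat ((i + j) choose j) * (dp_basis n (i + j) k :: 'a) else 0) else 0)"
    unfolding dp_mult_def sum_fun_apply dp_scale_def
    by (intro sum.cong refl) (use assms in \<open>auto simp: dp_basis_def\<close>)
  also have "\<dots> = of_nat ((i + j) choose j) * (dp_basis n (i + j) k :: 'a)"
    using assms by simp
  finally show "dp_mult n (dp_basis n i) (dp_basis n j) k =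
    (of_nat ((i + j) choose j) *\<^sub>d (dp_basis n (i + j) :: nat \<Rightarrow> 'a)) k"
    by (simp add: dp_scale_def)
qed

lemma dp_basis_eq_0: "CHAR('a) ^ n \<le> k \<Longrightarrow> (dp_basis n k :: nat \<Rightarrow> 'a::field) = 0"
  by (auto simp: dp_basis_def fun_eq_iff)

lemma dp_deriv_basis_0: "dp_deriv (dp_basis n 0) = 0"
  by (auto simp: dp_basis_def dp_deriv_def fun_eq_iff)

lemma dp_deriv_basis_Suc:
  "Suc i < CHAR('a) ^ n \<Longrightarrow>
    dp_deriv (dp_basis n (Suc i) :: nat \<Rightarrow> 'a::field) = dp_basis n i"
  by (auto simp: dp_basis_def dp_deriv_def fun_eq_iff)

lemma zass_expansion:
  assumes "q \<in> dp_space n"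
  shows "q = (\<Sum>i = -1 .. int (CHAR('a) ^ n) - 2. zass_coeff q i *\<^sub>d (zass_e n i :: nat \<Rightarrow> 'a::field))"
proof
  fix k
  have "(\<Sum>i = -1 .. int (CHAR('a) ^ n) - 2. zass_coeff q i *\<^sub>d zass_e n i) k =
    (\<Sum>i = -1 .. int (CHAR('a) ^ n) - 2. if i = int k - 1 then q k else 0)"
    unfolding sum_fun_apply
    by (intro sum.cong refl)
      (auto simp: dp_scale_def zass_coeff_def zass_e_def dp_basis_def nat_less_iff)
  also have "\<dots> = q k"
    using assms by (cases "k < CHAR('a) ^ n")
      (auto simp: dp_space_def not_less simp flip: of_nat_power)
  finally show "q k = (\<Sum>i = -1 .. int (CHAR('a) ^ n) - 2. zass_coeff q i *\<^sub>d zass_e n i) k" ..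
qed

end

theory Submission
  imports Defs "HOL-Algebra.Exponent"
begin

text \<open>
  An automorphism \<open>\<Phi>\<close> of the divided powers algebra with \<open>\<partial> \<circ> \<Phi> = v \<cdot> (\<Phi> \<circ> \<partial>)\<close> for a unit \<open>v\<close>
  induces the automorphism \<open>f \<partial> \<mapsto> v\<^sup>-\<^sup>1 \<Phi>(f) \<partial>\<close> of the Zassenhaus algebra, which carries the product
  given by \<open>q\<close> to the one given by \<open>v \<Phi>(q)\<close>. Scaling \<open>x\<close> makes the leading coefficient of \<open>q\<close> equal
  to 1. For the other coefficients take the truncated Taylor shift
  \<open>\<Phi>(f) = (\<Sum>j<p. h\<^sup>j \<partial>\<^sup>j f / j!)\<close> with \<open>h = b x\<^sup>(\<^sup>s\<^sup>+\<^sup>1\<^sup>)\<close> and \<open>v = 1 + \<partial>h\<close>. The required identity holds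
  as soon as \<open>\<partial>h h\<^sup>p\<^sup>-\<^sup>1 = 0\<close>, which is the case if \<open>s + 1\<close> is not a power of \<open>p\<close>. Now
  \<open>v \<Phi>(q)\<close> agrees with \<open>q + \<partial>(h q)\<close> up to degree \<open>m + s\<close>, hence the coefficient of \<open>q\<close> in degree
  \<open>m + s\<close> changes by \<open>b\<close> times the binomial coefficient of \<open>m + s + 1\<close> over \<open>m\<close>, and the lower ones
  do not change. So the degrees outside \<open>E\<^sub>m\<close> can be cleared one after another.
\<close>

section \<open>The full divided powers algebra\<close>

text \<open>
  All coefficient sequences, without truncation, form a commutative ring, and the truncated
  algebra is a subring of it when the characteristic is positive. Ring identities are proved by
  induction on the coefficient index: the zeroth coefficient is multiplicative, and the
  shift is a derivation.
\<close>

typedef 'a hurwitz = "UNIV :: (nat \<Rightarrow> 'a) set"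
  morphisms hnth Hurwitz ..

lemma hnth_Hurwitz [simp]: "hnth (Hurwitz f) = f"
  by (simp add: Hurwitz_inverse)

lemma Hurwitz_hnth [simp]: "Hurwitz (hnth F) = F"
  by (simp add: hnth_inverse)

lemma hurwitz_eqI: "(\<And>k. hnth F k = hnth G k) \<Longrightarrow> F = G"
  by (simp add: ext flip: hnth_inject)

text \<open>The product is the binomial convolution that the rule for the basis dictates; the result
  is known as the ring of Hurwitz series. A separate type is used because functions already carry
  the pointwise product.\<close>

instantiation hurwitz :: (comm_ring_1) "{zero, one, plus, minus, uminus, times}"
begin

definition "0 = Hurwitz (\<lambda>_. 0)"
definition "1 = Hurwitz (\<lambda>k. if k = 0 then 1 else 0)"
definition "F + G = Hurwitz (\<lambda>k. hnth F k + hnth G k)"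
definition "F - G = Hurwitz (\<lambda>k. hnth F k - hnth G k)"
definition "- F = Hurwitz (\<lambda>k. - hnth F k)"
definition "F * G = Hurwitz (\<lambda>k. \<Sum>i\<le>k. of_nat (k choose i) * hnth F i * hnth G (k - i))"

instance ..

end

lemma hnth_zero [simp]: "hnth 0 k = 0"
  and hnth_one: "hnth 1 k = (if k = 0 then 1 else 0)"
  and hnth_add [simp]: "hnth (F + G) k = hnth F k + hnth G k"
  and hnth_diff [simp]: "hnth (F - G) k = hnth F k - hnth G k"
  and hnth_uminus [simp]: "hnth (- F) k = - hnth F k"
  and hnth_mult: "hnth (F * G) k = (\<Sum>i\<le>k. of_nat (k choose i) * hnth F i * hnth G (k - i))"
  by (simp_all add: zero_hurwitz_def one_hurwitz_def plus_hurwitz_def minus_hurwitz_def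
      uminus_hurwitz_def times_hurwitz_def)

definition hderiv :: "'a hurwitz \<Rightarrow> 'a hurwitz"
  where "hderiv F = Hurwitz (\<lambda>k. hnth F (Suc k))"

lemma hnth_hderiv [simp]: "hnth (hderiv F) k = hnth F (Suc k)"
  by (simp add: hderiv_def)

lemma hderiv_add: "hderiv (F + G) = hderiv F + hderiv G"
  by (rule hurwitz_eqI) simp

lemma hderiv_zero [simp]: "hderiv 0 = 0"
  by (rule hurwitz_eqI) simp

lemma hderiv_one [simp]: "hderiv 1 = 0"
  by (rule hurwitz_eqI) (simp add: hnth_one)

lemma hderiv_mult: "hderiv (F * G) = hderiv F * G + F * hderiv G"
proof (rule hurwitz_eqI)
  fix k
  \<comment> \<open>The added top term vanishes because \<open>k choose Suc k\<close> is 0. After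
    the shift of the index, Pascal's rule splits the coefficients of the product into those of the
    two summands.\<close>
  have "(\<Sum>i\<le>k. of_nat (k choose i) * hnth F i * hnth G (Suc (k - i))) =
    (\<Sum>i\<le>Suc k. of_nat (k choose i) * hnth F i * hnth G (Suc k - i))"
    by (auto simp: Suc_diff_le binomial_eq_0 intro!: sum.cong)
  also have "\<dots> = hnth F 0 * hnth G (Suc k) +
    (\<Sum>i\<le>k. of_nat (k choose Suc i) * hnth F (Suc i) * hnth G (k - i))"
    by (subst sum.atMost_Suc_shift) simp
  finally show "hnth (hderiv (F * G)) k = hnth (hderiv F * G + F * hderiv G) k"
    unfolding hnth_hderiv hnth_add hnth_mult
    by (subst sum.atMost_Suc_shift) (simp add: algebra_simps sum.distrib)
qed

lemma hnth_mult_0 [simp]: "hnth (F * G) 0 = hnth F 0 * hnth G 0"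
  by (simp add: hnth_mult)

lemma hnth_Suc: "hnth F (Suc k) = hnth (hderiv F) k"
  by simp

instance hurwitz :: (comm_ring_1) comm_ring_1
proof
  fix F G H :: "'a hurwitz"
  have "hnth (F * G) k = hnth (G * F) k" for k and F G :: "'a hurwitz"
    by (induction k arbitrary: F G) (simp_all add: hnth_Suc hderiv_mult del: hnth_hderiv)
  then show comm: "F * G = G * F" for F G :: "'a hurwitz"
    by (intro hurwitz_eqI)
  show distr: "(F + G) * H = F * H + G * H" for F G H :: "'a hurwitz"
    by (rule hurwitz_eqI) (simp add: hnth_mult algebra_simps sum.distrib)
  have distr': "H * (F + G) = H * F + H * G" for F G H :: "'a hurwitz"
    using distr[of F G H] comm by metis
  have "hnth (F * G * H) k = hnth (F * (G * H)) k" for k and F G H :: "'a hurwitz"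
    by (induction k arbitrary: F G H)
      (simp_all add: hnth_Suc hderiv_mult distr distr' hderiv_add del: hnth_hderiv)
  then show "F * G * H = F * (G * H)"
    by (intro hurwitz_eqI)
  have "hnth (1 * F) k = hnth F k" for k and F :: "'a hurwitz"
  proof (induction k arbitrary: F)
    case (Suc k)
    have "0 * F = 0" for F :: "'a hurwitz"
      by (rule hurwitz_eqI) (simp add: hnth_mult)
    with Suc show ?case
      by (simp add: hnth_Suc hderiv_mult del: hnth_hderiv) 
  qed (simp add: hnth_one)
  then show "1 * F = F"
    by (intro hurwitz_eqI)
  show "(0::'a hurwitz) \<noteq> 1"
    by (metis hnth_one hnth_zero zero_neq_one)
qed (rule hurwitz_eqI; simp add: algebra_simps)+

section \<open>Constants and divided power monomials\<close>

definition hconst :: "'a::comm_ring_1 \<Rightarrow> 'a hurwitz"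
  where "hconst c = Hurwitz (\<lambda>k. if k = 0 then c else 0)"

lemma hnth_hconst: "hnth (hconst c) k = (if k = 0 then c else 0)"
  by (simp add: hconst_def)

lemma hconst_1 [simp]: "hconst 1 = 1"
  by (rule hurwitz_eqI) (simp add: hnth_hconst hnth_one)

lemma hconst_0 [simp]: "hconst 0 = 0"
  by (rule hurwitz_eqI) (simp add: hnth_hconst)

lemma hnth_hconst_mult [simp]: "hnth (hconst c * F) k = c * hnth F k"
proof -
  have "hnth (hconst c * F) k = (\<Sum>i\<in>{0}. of_nat (k choose i) * hnth (hconst c) i * hnth F (k - i))"
    unfolding hnth_mult by (rule sum.mono_neutral_right) (auto simp: hnth_hconst)
  then show ?thesis
    by (simp add: hnth_hconst)
qed

lemma hconst_mult: "hconst (c * d) = hconst c * hconst d"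
  by (rule hurwitz_eqI) (simp add: hnth_hconst)

lemma hderiv_hconst [simp]: "hderiv (hconst c) = 0"
  by (rule hurwitz_eqI) (simp add: hnth_hconst)

lemma hderiv_hconst_mult: "hderiv (hconst c * F) = hconst c * hderiv F"
  by (simp add: hderiv_mult)

lemma hnth_sum: "hnth (\<Sum>i\<in>A. F i) k = (\<Sum>i\<in>A. hnth (F i) k)"
  by (induction A rule: infinite_finite_induct) auto

lemma hderiv_sum: "hderiv (\<Sum>i\<in>A. F i) = (\<Sum>i\<in>A. hderiv (F i))"
  by (rule hurwitz_eqI) (simp add: hnth_sum)

lemma hderiv_power: "hderiv (F ^ Suc k) = of_nat (Suc k) * F ^ k * hderiv F"
  by (induction k) (simp_all add: hderiv_mult algebra_simps)

lemma of_nat_hurwitz: "of_nat k = hconst (of_nat k)"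
proof (induction k)
  case (Suc k)
  then show ?case
    by (intro hurwitz_eqI) (auto simp: hnth_hconst hnth_one)
qed simp

definition hmonom :: "nat \<Rightarrow> 'a::comm_ring_1 hurwitz"
  where "hmonom i = Hurwitz (\<lambda>k. if k = i then 1 else 0)"

lemma hnth_hmonom: "hnth (hmonom i) k = (if k = i then 1 else 0)"
  by (simp add: hmonom_def)

lemma hnth_hmonom_mult:
  "hnth (hmonom i * F) k = (if i \<le> k then of_nat (k choose i) * hnth F (k - i) else 0)"
proof -
  have "hnth (hmonom i * F) k =
    (\<Sum>j\<le>k. if j = i then of_nat (k choose j) * hnth F (k - j) else 0)"
    unfolding hnth_mult by (intro sum.cong) (auto simp: hnth_hmonom)
  then show ?thesis
    by simp
qed

lemma hmonom_mult: "hmonom i * hmonom j = hconst (of_nat ((i + j) choose i)) * hmonom (i + j)"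
  by (rule hurwitz_eqI) (auto simp: hnth_hmonom_mult hnth_hmonom)

lemma hderiv_hmonom_Suc [simp]: "hderiv (hmonom (Suc i)) = hmonom i"
  by (rule hurwitz_eqI) (simp add: hnth_hmonom)

section \<open>The truncated algebra as a subring\<close>

text \<open>Absorption makes \<open>p ^ n\<close> divide \<open>a\<close> times the binomial
  coefficient. If \<open>p\<close> did not divide the latter, all of \<open>p ^ n\<close> would
  divide the smaller number \<open>a\<close>.\<close>

lemma prime_dvd_choose_prime_power:
  fixes p :: nat
  assumes "prime p" "0 < a" "a < p ^ n"
  shows "p dvd p ^ n choose a"
proof (rule ccontr)
  assume "\<not> p dvd p ^ n choose a"
  then have "coprime (p ^ n) (p ^ n choose a)"
    using assms by (simp add: prime_imp_coprime)
  moreover have "p ^ n dvd a * (p ^ n choose a)"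
    using assms by (simp add: times_binomial_minus1_eq)
  ultimately have "p ^ n dvd a"
    by (simp add: coprime_dvd_mult_left_iff)
  with assms show False
    by (simp add: nat_dvd_not_less)
qed

text \<open>A case of Kummer's theorem, by Vandermonde's identity for \<open>p ^ n + l\<close> over
  \<open>i\<close>: the term \<open>k = 0\<close> vanishes because \<open>l < i\<close>, and the
  others have a factor \<open>p ^ n choose k\<close> with \<open>0 < k < p ^ n\<close>.\<close>

lemma prime_dvd_choose_carry:
  fixes p :: nat
  assumes "prime p" "i < p ^ n" "j < p ^ n" "p ^ n \<le> i + j"
  shows "p dvd (i + j) choose i"
proof -
  define l where "l = i + j - p ^ n"
  have "i + j = p ^ n + l" "l < i"
    using assms by (auto simp: l_def)
  have "p dvd (p ^ n choose k) * (l choose (i - k))" if "k \<le> i" for k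
    using prime_dvd_choose_prime_power[of p k n] \<open>l < i\<close> that assms
    by (cases "k = 0") (auto simp: binomial_eq_0)
  then have "p dvd (\<Sum>k\<le>i. (p ^ n choose k) * (l choose (i - k)))"
    by (intro dvd_sum) auto
  then show ?thesis
    by (simp add: vandermonde \<open>i + j = p ^ n + l\<close>)
qed

definition hspace :: "nat \<Rightarrow> 'a::field hurwitz set"
  where "hspace n = {F. hnth F \<in> dp_space n}"

lemma hspace_iff: "F \<in> hspace n \<longleftrightarrow> (\<forall>k\<ge>CHAR('a) ^ n. hnth F k = 0)"
  for F :: "'a::field hurwitz"
  by (simp add: hspace_def dp_space_def)

lemma hspace_zero: "0 \<in> hspace n"
  and hspace_add: "F \<in> hspace n \<Longrightarrow> G \<in> hspace n \<Longrightarrow> F + G \<in> hspace n"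
  and hspace_diff: "F \<in> hspace n \<Longrightarrow> G \<in> hspace n \<Longrightarrow> F - G \<in> hspace n"
  and hspace_uminus: "F \<in> hspace n \<Longrightarrow> - F \<in> hspace n"
  and hspace_hconst_mult: "F \<in> hspace n \<Longrightarrow> hconst c * F \<in> hspace n"
  and hspace_hderiv: "F \<in> hspace n \<Longrightarrow> hderiv F \<in> hspace n"
  by (simp_all add: hspace_iff)

lemma hspace_hmonom: "i < CHAR('a) ^ n \<Longrightarrow> (hmonom i :: 'a::field hurwitz) \<in> hspace n"
  by (auto simp: hspace_iff hnth_hmonom)

lemma hspace_sum: "(\<And>i. i \<in> A \<Longrightarrow> F i \<in> hspace n) \<Longrightarrow> (\<Sum>i\<in>A. F i) \<in> hspace n"
  by (induction A rule: infinite_finite_induct) (auto simp: hspace_zero hspace_add)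

lemma hspace_hconst: "CHAR('a) > 0 \<Longrightarrow> hconst c \<in> hspace n" for c :: "'a::field"
  by (auto simp: hspace_iff hnth_hconst)

lemma hspace_one: "CHAR('a) > 0 \<Longrightarrow> (1 :: 'a::field hurwitz) \<in> hspace n"
  using hspace_hconst[of 1] by simp

text \<open>In degrees from \<open>p ^ n\<close> on, a term with both factors in range carries a
  binomial coefficient divisible by the characteristic. So the truncation is automatic.\<close>

lemma hspace_mult:
  fixes F G :: "'a::field hurwitz"
  assumes "CHAR('a) > 0" "F \<in> hspace n" "G \<in> hspace n"
  shows "F * G \<in> hspace n"
  unfolding hspace_iff
proof (intro allI impI)
  fix k assume k: "CHAR('a) ^ n \<le> k"
  have "of_nat (k choose i) * hnth F i * hnth G (k - i) = 0" if "i \<le> k" for i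
  proof (cases "i < CHAR('a) ^ n \<and> k - i < CHAR('a) ^ n")
    case True
    then have "of_nat (k choose i) = (0 :: 'a)"
      using prime_dvd_choose_carry[OF prime_CHAR_semidom[OF assms(1)], of i n "k - i"] k that
      by (simp add: of_nat_eq_0_iff_char_dvd)
    then show ?thesis
      by simp
  qed (use assms in \<open>auto simp: hspace_iff not_less\<close>)
  then show "hnth (F * G) k = 0"
    unfolding hnth_mult by (intro sum.neutral) auto
qed

lemma hspace_power:
  fixes F :: "'a::field hurwitz"
  assumes "CHAR('a) > 0" "F \<in> hspace n"
  shows "F ^ k \<in> hspace n"
  by (induction k) (auto simp: assms hspace_one hspace_mult)

lemma dp_mult_eq_hurwitz:
  fixes f g :: "nat \<Rightarrow> 'a::field"
  assumes char: "CHAR('a) > 0" and fg: "f \<in> dp_space n" "g \<in> dp_space n"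
  shows "dp_mult n f g = hnth (Hurwitz f * Hurwitz g)"
proof
  fix k
  let ?N = "CHAR('a) ^ n"
  have expand: "dp_mult n f g k =
    (\<Sum>a<?N. \<Sum>b<?N. f a * g b * of_nat ((a + b) choose b) * dp_basis n (a + b) k)"
    by (simp add: dp_mult_def sum_fun_apply dp_scale_def)
  show "dp_mult n f g k = hnth (Hurwitz f * Hurwitz g) k"
  proof (cases "k < ?N")
    case True
    have "(\<Sum>b<?N. f a * g b * of_nat ((a + b) choose b) * dp_basis n (a + b) k) =
      (if a \<le> k then f a * g (k - a) * of_nat (k choose a) else 0)" for a
    proof -
      have "k - a < ?N" "a \<le> k \<Longrightarrow> k choose (k - a) = k choose a"
        using True by (simp_all add: binomial_symmetric[symmetric])
      \<comment> \<open>The basis vector selects \<open>b = k - a\<close>. The guard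
        \<open>a \<le> k\<close> excludes the values produced by truncated subtraction.\<close>
      moreover have "(\<Sum>b<?N. f a * g b * of_nat ((a + b) choose b) * dp_basis n (a + b) k) =
        (\<Sum>b<?N. if b = k - a then
          (if a \<le> k then f a * g (k - a) * of_nat (k choose (k - a)) else 0) else 0)"
        using True by (intro sum.cong) (auto simp: dp_basis_def)
      ultimately show ?thesis
        by simp
    qed
    then have "dp_mult n f g k =
      (\<Sum>a<?N. if a \<le> k then f a * g (k - a) * of_nat (k choose a) else 0)"
      by (simp add: expand)
    also have "\<dots> = (\<Sum>a\<le>k. f a * g (k - a) * of_nat (k choose a))"
      using True by (intro sum.mono_neutral_cong_right) auto
    finally show ?thesis
      by (simp add: hnth_mult mult_ac)
  next
    case False
    then have "dp_mult n f g k = 0"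
      unfolding expand by (intro sum.neutral ballI) (auto simp: dp_basis_def)
    moreover have "Hurwitz f * Hurwitz g \<in> hspace n"
      using fg by (intro hspace_mult char) (auto simp: hspace_def)
    ultimately show ?thesis
      using False by (simp add: hspace_iff)
  qed
qed

lemma dp_deriv_eq_hurwitz: "dp_deriv f = hnth (hderiv (Hurwitz f))"
  by (auto simp: dp_deriv_def)

lemma hnth_mult_lowest:
  assumes "\<And>i. i < k \<Longrightarrow> hnth G i = 0"
  shows "hnth (F * G) k = hnth F 0 * hnth G k"
proof -
  have "hnth (F * G) k = (\<Sum>i\<in>{0}. of_nat (k choose i) * hnth F i * hnth G (k - i))"
    unfolding hnth_mult using assms by (intro sum.mono_neutral_right) auto
  then show ?thesis
    by simp
qed

lemma hnth_mult_cong: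
  assumes "\<And>i. i \<le> k \<Longrightarrow> hnth G i = hnth H i"
  shows "hnth (F * G) k = hnth (F * H) k"
  unfolding hnth_mult using assms by (intro sum.cong) auto

section \<open>Isomorphisms induced by admissible automorphisms\<close>

text \<open>
  Multiplicativity and bijectivity of \<open>\<Phi>\<close> follow from the commutation rule with the derivation.
\<close>

locale admissible_map =
  fixes n :: nat and \<Phi> :: "'a::field hurwitz \<Rightarrow> 'a hurwitz" and v u :: "'a hurwitz"
  assumes char_pos: "CHAR('a) > 0"
    and map_add: "\<Phi> (F + G) = \<Phi> F + \<Phi> G"
    and hnth_map_0: "hnth (\<Phi> F) 0 = hnth F 0"
    and hderiv_map: "hderiv (\<Phi> F) = v * \<Phi> (hderiv F)"
    and map_hspace: "F \<in> hspace n \<Longrightarrow> \<Phi> F \<in> hspace n"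
    and v_hspace: "v \<in> hspace n"
    and u_hspace: "u \<in> hspace n"
    and uv: "u * v = 1"
begin

lemma map_zero [simp]: "\<Phi> 0 = 0"
  using map_add[of 0 0] by simp

lemma map_diff: "\<Phi> (F - G) = \<Phi> F - \<Phi> G"
  using map_add[of "F - G" G] by simp

lemma map_hconst: "\<Phi> (hconst c) = hconst c"
proof (rule hurwitz_eqI)
  show "hnth (\<Phi> (hconst c)) k = hnth (hconst c) k" for k
    by (cases k) (simp_all add: hnth_map_0 hnth_Suc hderiv_map del: hnth_hderiv)
qed

lemma map_mult: "\<Phi> (F * G) = \<Phi> F * \<Phi> G"
proof (rule hurwitz_eqI)
  show "hnth (\<Phi> (F * G)) k = hnth (\<Phi> F * \<Phi> G) k" for k
  proof (induction k arbitrary: F G rule: less_induct)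
    case (less k)
    show ?case
    proof (cases k)
      case 0
      then show ?thesis
        by (simp add: hnth_map_0)
    next
      case (Suc j)
      have "hnth (\<Phi> (F * G)) k = hnth (v * \<Phi> (hderiv F * G + F * hderiv G)) j"
        by (simp add: Suc hnth_Suc hderiv_map hderiv_mult del: hnth_hderiv)
      \<comment> \<open>Coefficient \<open>j\<close> of a product with \<open>v\<close> involves
        only coefficients up to \<open>j < k\<close>, where the induction hypothesis holds for both
        Leibniz terms.\<close>
      also have "\<dots> = hnth (v * (\<Phi> (hderiv F) * \<Phi> G + \<Phi> F * \<Phi> (hderiv G))) j"
        using less by (intro hnth_mult_cong) (simp add: Suc map_add)
      also have "\<dots> = hnth (hderiv (\<Phi> F * \<Phi> G)) j"
        by (simp only: hderiv_mult hderiv_map distrib_left mult_ac)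
      finally show ?thesis
        by (simp add: Suc)
    qed
  qed
qed

lemma v_0_nonzero: "hnth v 0 \<noteq> 0"
  using arg_cong[OF uv, of "\<lambda>F. hnth F 0"] by (auto simp: hnth_one)

text \<open>\<open>\<Phi>\<close> is triangular for the filtration by lowest degree, with powers of
  the non-zero constant term of \<open>v\<close> on the diagonal. Differentiation lowers the degree
  by one and contributes one such factor.\<close>

lemma map_lowest:
  assumes "\<And>i. i < k \<Longrightarrow> hnth F i = 0"
  shows "(\<forall>i<k. hnth (\<Phi> F) i = 0) \<and> hnth (\<Phi> F) k = hnth v 0 ^ k * hnth F k"
  using assms
proof (induction k arbitrary: F)
  case 0
  then show ?case
    by (simp add: hnth_map_0)
next
  case (Suc k)
  then have IH: "\<forall>i<k. hnth (\<Phi> (hderiv F)) i = 0"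
      "hnth (\<Phi> (hderiv F)) k = hnth v 0 ^ k * hnth (hderiv F) k"
    using Suc.IH[of "hderiv F"] by auto
  have "hnth (\<Phi> F) (Suc j) = hnth v 0 * hnth (\<Phi> (hderiv F)) j" if "j \<le> k" for j
    unfolding hnth_Suc hderiv_map using IH that by (intro hnth_mult_lowest) auto
  then show ?case
    using IH Suc.prems by (auto simp: less_Suc_eq_0_disj hnth_map_0)
qed

lemma map_inj: "inj \<Phi>"
proof (rule injI)
  fix F G assume "\<Phi> F = \<Phi> G"
  then have 0: "\<Phi> (F - G) = 0"
    by (simp add: map_diff)
  have "hnth (F - G) k = 0" for k
  proof (induction k rule: less_induct)
    case (less k)
    then show ?case
      using map_lowest[of k "F - G"] v_0_nonzero 0 by auto
  qed
  then show "F = G"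
    by (intro hurwitz_eqI) simp
qed

lemma map_surj_hspace:
  assumes "G \<in> hspace n"
  shows "G \<in> \<Phi> ` hspace n"
proof -
  let ?N = "CHAR('a) ^ n"
  \<comment> \<open>Triangular elimination: \<open>d\<close> bounds the number of top degrees in
    which \<open>G\<close> may be non-zero, and each step removes the lowest of them with the image
    of a multiple of a monomial.\<close>
  have "G \<in> \<Phi> ` hspace n" if "G \<in> hspace n" "\<And>i. i < ?N - d \<Longrightarrow> hnth G i = 0" for d G
    using that
  proof (induction d arbitrary: G)
    case 0
    then have "G = 0"
      by (intro hurwitz_eqI) (metis diff_zero hnth_zero hspace_iff not_less)
    then show ?case
      using hspace_zero map_zero by (metis imageI)
  next
    case (Suc d)
    show ?case
    proof (cases "d < ?N")
      case True
      define k where "k = ?N - Suc d"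
      have k: "k < ?N" "?N - d = Suc k"
        using True by (auto simp: k_def)
      define M where "M = hconst (hnth G k / hnth v 0 ^ k) * hmonom k"
      have M: "M \<in> hspace n"
        unfolding M_def using k by (intro hspace_hconst_mult hspace_hmonom)
      have "(\<forall>i<k. hnth (\<Phi> M) i = 0) \<and> hnth (\<Phi> M) k = hnth v 0 ^ k * hnth M k"
        by (intro map_lowest) (simp add: M_def hnth_hmonom)
      then have "hnth (G - \<Phi> M) i = 0" if "i < Suc k" for i
        using that Suc.prems(2) v_0_nonzero
        by (auto simp: less_Suc_eq k_def[symmetric] M_def hnth_hmonom)
      then have "G - \<Phi> M \<in> \<Phi> ` hspace n"
        using Suc M k(2) by (intro Suc.IH) (auto simp: hspace_diff map_hspace)
      then obtain F where "F \<in> hspace n" "G - \<Phi> M = \<Phi> F"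
        by blast
      then have "G = \<Phi> (F + M)" "F + M \<in> hspace n"
        using M by (auto simp: map_add hspace_add algebra_simps)
      then show ?thesis
        by blast
    qed (use Suc in auto)
  qed
  from this[of G ?N] assms show ?thesis
    by simp
qed

lemma zass_alg_isomorphic:
  assumes q: "q \<in> dp_space n"
  shows "zass_alg n q \<cong>\<^sub>2 zass_alg n (hnth (v * \<Phi> (Hurwitz q)))"
proof -
  define \<phi> where "\<phi> f = hnth (u * \<Phi> (Hurwitz f))" for f
  note hspace_closed = hspace_mult[OF char_pos] hspace_diff hspace_hderiv map_hspace
    v_hspace u_hspace
  have mem: "Hurwitz f \<in> hspace n \<longleftrightarrow> f \<in> dp_space n" for f :: "nat \<Rightarrow> 'a"
    by (simp add: hspace_def)
  have mem': "hnth F \<in> dp_space n \<longleftrightarrow> F \<in> hspace n" for F :: "'a hurwitz"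
    by (simp add: hspace_def)
  have mult: "dp_mult n (hnth F) (hnth G) = hnth (F * G)"
    if "F \<in> hspace n" "G \<in> hspace n" for F G :: "'a hurwitz"
    using that by (simp add: dp_mult_eq_hurwitz char_pos mem')
  have bracket: "zass_bracket n (hnth F) (hnth G) = hnth (F * hderiv G - hderiv F * G)"
    if "F \<in> hspace n" "G \<in> hspace n" for F G :: "'a hurwitz"
    using that unfolding zass_bracket_def dp_deriv_eq_hurwitz
    by (simp add: mult hspace_hderiv fun_eq_iff)
  have map_hderiv: "\<Phi> (hderiv F) = u * hderiv (\<Phi> F)" for F
    using uv by (simp add: hderiv_map flip: mult.assoc)
  \<comment> \<open>The terms containing the derivative of \<open>u\<close> are symmetric in
    \<open>F\<close> and \<open>G\<close> and cancel.\<close>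
  have "u * \<Phi> (F * hderiv G - hderiv F * G) =
    u * \<Phi> F * hderiv (u * \<Phi> G) - hderiv (u * \<Phi> F) * (u * \<Phi> G)" for F G
    by (simp add: map_diff map_mult map_hderiv hderiv_mult algebra_simps)
  then have "\<phi> (zass_bracket n x y) = zass_bracket n (\<phi> x) (\<phi> y)"
    if "x \<in> dp_space n" "y \<in> dp_space n" for x y
    using that bracket[of "Hurwitz x" "Hurwitz y"]
    by (simp add: \<phi>_def bracket mem hspace_closed)
  \<comment> \<open>The two outer factors bring \<open>u\<close> twice, so the middle one must bring
    \<open>v\<close> to leave a single \<open>u\<close>.\<close>
  moreover have "u * \<Phi> (F * Q * G) = u * \<Phi> F * (v * \<Phi> Q) * (u * \<Phi> G)" for F G Q
  proof -
    have "u * \<Phi> F * (v * \<Phi> Q) * (u * \<Phi> G) = (u * v) * (u * \<Phi> (F * Q * G))"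
      by (simp only: map_mult mult_ac)
    then show ?thesis
      by (simp add: uv)
  qed
  then have "\<phi> (dp_mult n (dp_mult n x q) y) =
      dp_mult n (dp_mult n (\<phi> x) (hnth (v * \<Phi> (Hurwitz q)))) (\<phi> y)"
    if "x \<in> dp_space n" "y \<in> dp_space n" for x y
    using that q mult[of "Hurwitz x" "Hurwitz q"] mult[of "Hurwitz x * Hurwitz q" "Hurwitz y"]
    by (simp add: \<phi>_def mult mem hspace_closed)
  moreover have "\<phi> (x + y) = \<phi> x + \<phi> y" for x y
  proof -
    have "Hurwitz (x + y) = Hurwitz x + Hurwitz y"
      by (rule hurwitz_eqI) simp
    then show ?thesis
      by (simp add: \<phi>_def map_add distrib_left fun_eq_iff)
  qed
  moreover have "\<phi> (c *\<^sub>d x) = c *\<^sub>d \<phi> x" for c x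
  proof -
    have "Hurwitz (c *\<^sub>d x) = hconst c * Hurwitz x"
      by (rule hurwitz_eqI) (simp add: dp_scale_def)
    then have "u * \<Phi> (Hurwitz (c *\<^sub>d x)) = hconst c * (u * \<Phi> (Hurwitz x))"
      by (simp add: map_mult map_hconst mult_ac)
    then show ?thesis
      by (simp add: \<phi>_def dp_scale_def fun_eq_iff)
  qed
  moreover have "bij_betw \<phi> (dp_space n) (dp_space n)"
  proof (rule bij_betw_imageI)
    show "inj_on \<phi> (dp_space n)"
    proof (rule inj_onI)
      fix x y :: "nat \<Rightarrow> 'a" assume "\<phi> x = \<phi> y"
      then have "v * (u * \<Phi> (Hurwitz x)) = v * (u * \<Phi> (Hurwitz y))"
        by (simp add: \<phi>_def hnth_inject)
      then have "\<Phi> (Hurwitz x) = \<Phi> (Hurwitz y)"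
        using uv by (simp add: mult.commute[of v u] flip: mult.assoc)
      then show "x = y"
        using map_inj by (metis hnth_Hurwitz injD)
    qed
    show "\<phi> ` dp_space n = dp_space n"
    proof (intro equalityI subsetI)
      fix y :: "nat \<Rightarrow> 'a" assume "y \<in> dp_space n"
      then have "v * Hurwitz y \<in> \<Phi> ` hspace n"
        by (intro map_surj_hspace) (simp add: mem hspace_closed)
      then obtain F where F: "F \<in> hspace n" "v * Hurwitz y = \<Phi> F"
        by blast
      have "\<phi> (hnth F) = hnth (u * v * Hurwitz y)"
        by (simp add: \<phi>_def mult.assoc flip: F(2))
      then have "\<phi> (hnth F) = y"
        by (simp add: uv)
      then show "y \<in> \<phi> ` dp_space n"
        using F(1) by (auto simp: hspace_def)
    qed (auto simp: \<phi>_def mem' mem hspace_closed)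
  qed
  ultimately show ?thesis
    unfolding alg_isomorphic_def zass_alg_def by auto
qed

end

section \<open>Truncated Taylor shifts\<close>

definition hvanish :: "nat \<Rightarrow> 'a::comm_ring_1 hurwitz \<Rightarrow> bool"
  where "hvanish d F \<longleftrightarrow> (\<forall>i<d. hnth F i = 0)"

lemma hvanish_0 [simp]: "hvanish 0 F"
  by (simp add: hvanish_def)

lemma hvanish_mono: "hvanish d F \<Longrightarrow> e \<le> d \<Longrightarrow> hvanish e F"
  by (simp add: hvanish_def)

lemma hvanish_mult:
  assumes "hvanish d F" "hvanish e G"
  shows "hvanish (d + e) (F * G)"
  unfolding hvanish_def
proof (intro allI impI)
  fix k assume "k < d + e"
  then have "hnth F i = 0 \<or> hnth G (k - i) = 0" if "i \<le> k" for i
    using that assms by (cases "i < d") (simp_all add: hvanish_def)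
  then show "hnth (F * G) k = 0"
    unfolding hnth_mult by (intro sum.neutral ballI) fastforce
qed

lemma hvanish_hconst_mult: "hvanish d F \<Longrightarrow> hvanish d (hconst c * F)"
  by (simp add: hvanish_def)

lemma hvanish_add: "hvanish d F \<Longrightarrow> hvanish d G \<Longrightarrow> hvanish d (F + G)"
  by (simp add: hvanish_def)

lemma hvanish_sum: "(\<And>i. i \<in> A \<Longrightarrow> hvanish d (F i)) \<Longrightarrow> hvanish d (\<Sum>i\<in>A. F i)"
  by (simp add: hvanish_def hnth_sum)

lemma hvanish_power: "hvanish d F \<Longrightarrow> hvanish (k * d) (F ^ k)"
  by (induction k) (auto intro: hvanish_mult)

lemma hvanish_hderiv: "hvanish d F \<Longrightarrow> hvanish (d - 1) (hderiv F)"
  by (simp add: hvanish_def)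

lemma hvanish_hderiv_funpow: "hvanish d F \<Longrightarrow> hvanish (d - j) ((hderiv ^^ j) F)"
proof (induction j)
  case (Suc j)
  then show ?case
    using hvanish_hderiv[of "d - j"] by simp
qed simp

lemma hmonom_0 [simp]: "hmonom 0 = 1"
  by (rule hurwitz_eqI) (simp add: hnth_hmonom hnth_one)

text \<open>Powers of the monomial are multiples of monomials. The last multiplication, into degree
  \<open>p * c\<close>, brings the coefficient of \<open>p * c\<close> over \<open>c\<close>, which
  absorption shows to be a multiple of \<open>p\<close>.\<close>

lemma hmonom_power_CHAR:
  assumes "CHAR('a::field) > 0" "c > 0"
  shows "(hmonom c :: 'a hurwitz) ^ CHAR('a) = 0"
proof -
  let ?p = "CHAR('a)"
  have "\<exists>d. (hmonom c :: 'a hurwitz) ^ k = hconst d * hmonom (k * c)" for k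
  proof (induction k)
    case 0
    show ?case
      by (intro exI[of _ 1]) simp
  next
    case (Suc k)
    then obtain d where "(hmonom c :: 'a hurwitz) ^ k = hconst d * hmonom (k * c)"
      by blast
    then have "(hmonom c :: 'a hurwitz) ^ Suc k = hconst d * (hmonom c * hmonom (k * c))"
      by (simp add: mult_ac)
    also have "\<dots> = hconst (d * of_nat ((c + k * c) choose c)) * hmonom (Suc k * c)"
      by (simp add: hmonom_mult hconst_mult mult.assoc)
    finally show ?case
      by blast
  qed
  then obtain d where d: "(hmonom c :: 'a hurwitz) ^ (?p - 1) = hconst d * hmonom ((?p - 1) * c)"
    by blast
  have "c + (?p - 1) * c = ?p * c"
    using assms(1) by (cases ?p) simp_all
  moreover have "c * ((?p * c) choose c) = c * (?p * ((?p * c - 1) choose (c - 1)))"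
    using assms(2) by (simp add: times_binomial_minus1_eq)
  then have "(?p * c) choose c = ?p * ((?p * c - 1) choose (c - 1))"
    using assms(2) by simp
  ultimately have "hmonom c * hmonom ((?p - 1) * c) = (0 :: 'a hurwitz)"
    by (simp add: hmonom_mult)
  moreover have "(hmonom c :: 'a hurwitz) ^ ?p = hmonom c * hmonom c ^ (?p - 1)"
    using assms(1) by (simp flip: power_Suc)
  then have "(hmonom c :: 'a hurwitz) ^ ?p = hconst d * (hmonom c * hmonom ((?p - 1) * c))"
    unfolding d by (simp only: mult.left_commute[of "hmonom c" "hconst d"])
  ultimately show ?thesis
    by simp
qed

lemma hmonom_split:
  assumes "of_nat ((i + j) choose i) \<noteq> (0 :: 'a::field)"
  obtains d :: "'a::field" where "hmonom (i + j) = hconst d * hmonom i * hmonom j"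
proof
  show "hmonom (i + j) = hconst (1 / of_nat ((i + j) choose i) :: 'a) * hmonom i * hmonom j"
    by (rule hurwitz_eqI) (simp add: mult.assoc hmonom_mult assms)
qed

text \<open>
  With \<open>a\<close> the largest power of \<open>p\<close> dividing \<open>r\<close> and \<open>c = r - a\<close>, both \<open>x\<^sup>(\<^sup>r\<^sup>)\<close> and \<open>x\<^sup>(\<^sup>r\<^sup>-\<^sup>1\<^sup>)\<close>
  are multiples of \<open>x\<^sup>(\<^sup>c\<^sup>)\<close>, so the product contains the \<open>p\<close>-th power of \<open>x\<^sup>(\<^sup>c\<^sup>)\<close>, which is 0.
\<close>

lemma hmonom_pred_mult_power:
  assumes char: "CHAR('a::field) > 0" and r: "r > 0" "\<nexists>j. r = CHAR('a) ^ j"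
  shows "(hmonom (r - 1) :: 'a hurwitz) * hmonom r ^ (CHAR('a) - 1) = 0"
proof -
  define p where "p = CHAR('a)"
  have p: "prime p"
    unfolding p_def using char by (rule prime_CHAR_semidom)
  obtain u where u: "r = p ^ multiplicity p r * u" "\<not> p dvd u"
    using multiplicity_decompose'[of r p] r(1) p by (metis less_not_refl not_prime_unit)
  define a where "a = p ^ multiplicity p r"
  have ru: "r = a * u"
    unfolding a_def by (rule u(1))
  have "a > 0"
    using p by (simp add: a_def prime_gt_0_nat)
  have "u \<noteq> 0"
    using u(2) by (metis dvd_0_right)
  have "u \<noteq> 1"
  proof
    assume "u = 1"
    with ru have "r = a"
      by simp
    with r(2) show False
      unfolding a_def p_def by blast
  qed
  define c where "c = a * (u - 1)"
  have r_eq: "r = a + c"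
    unfolding ru c_def using \<open>u \<noteq> 0\<close> by (cases u) simp_all
  have "c > 0"
    using \<open>u \<noteq> 0\<close> \<open>u \<noteq> 1\<close> \<open>a > 0\<close> by (simp add: c_def)
  \<comment> \<open>By \<open>const_p_fac\<close>, \<open>p\<close> has the same multiplicity in
    \<open>r choose a\<close> as in \<open>u\<close>.\<close>
  have "multiplicity p (r choose a) = 0"
    using const_p_fac[of u p "multiplicity p r"] p u(2) \<open>u \<noteq> 0\<close>
    by (simp add: not_dvd_imp_multiplicity_0 flip: a_def ru)
  moreover have "r choose a \<noteq> 0"
    by (simp add: r_eq)
  ultimately have ndvd: "\<not> p dvd r choose a"
    using p by (metis multiplicity_eq_zero_iff not_prime_unit)
  \<comment> \<open>Absorption transfers the non-divisibility to \<open>r - 1\<close> over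
    \<open>a - 1\<close>, so that the monomial of degree \<open>c\<close> also splits off from that
    of degree \<open>r - 1\<close>.\<close>
  have "a * (r choose a) = a * (u * ((r - 1) choose (a - 1)))"
    using \<open>a > 0\<close> by (simp add: times_binomial_minus1_eq ru)
  then have "r choose a = u * ((r - 1) choose (a - 1))"
    using \<open>a > 0\<close> by simp
  with ndvd have "\<not> p dvd (r - 1) choose (a - 1)"
    by auto
  moreover have r_eq': "r - 1 = (a - 1) + c"
    using \<open>a > 0\<close> by (simp add: r_eq)
  ultimately have "of_nat ((a - 1 + c) choose (a - 1)) \<noteq> (0 :: 'a)"
    by (simp add: of_nat_eq_0_iff_char_dvd p_def)
  then obtain d' :: 'a where "hmonom (r - 1) = hconst d' * hmonom (a - 1) * hmonom c"
    unfolding r_eq' by (rule hmonom_split)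
  moreover have "of_nat ((a + c) choose a) \<noteq> (0 :: 'a)"
    using ndvd by (simp add: of_nat_eq_0_iff_char_dvd p_def r_eq)
  then obtain d :: 'a where "hmonom r = hconst d * hmonom a * hmonom c"
    unfolding r_eq by (rule hmonom_split)
  ultimately have "(hmonom (r - 1) :: 'a hurwitz) * hmonom r ^ (p - 1) =
    hconst d' * hmonom (a - 1) * (hconst d * hmonom a) ^ (p - 1) * (hmonom c * hmonom c ^ (p - 1))"
    by (simp only: power_mult_distrib mult_ac)
  also have "(hmonom c :: 'a hurwitz) * hmonom c ^ (p - 1) = hmonom c ^ p"
    using p by (simp add: prime_gt_0_nat flip: power_Suc)
  finally show ?thesis
    using hmonom_power_CHAR[OF char \<open>c > 0\<close>] by (simp add: p_def)
qed

text \<open>The sum stops before \<open>j!\<close> becomes zero in \<open>'a\<close>.\<close>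

definition htaylor :: "'a::field hurwitz \<Rightarrow> 'a hurwitz \<Rightarrow> 'a hurwitz"
  where "htaylor h F = (\<Sum>j<CHAR('a). hconst (1 / of_nat (fact j)) * h ^ j * (hderiv ^^ j) F)"

lemma funpow_hderiv_add: "(hderiv ^^ j) (F + G) = (hderiv ^^ j) F + (hderiv ^^ j) G"
  by (induction j) (simp_all add: hderiv_add)

lemma funpow_hderiv_hspace: "F \<in> hspace n \<Longrightarrow> (hderiv ^^ j) F \<in> hspace n"
  by (induction j) (simp_all add: hspace_hderiv)

lemma htaylor_add: "htaylor h (F + G) = htaylor h F + htaylor h G"
  by (simp add: htaylor_def funpow_hderiv_add algebra_simps sum.distrib)

lemma hnth_htaylor_0:
  fixes h F :: "'a::field hurwitz"
  assumes "CHAR('a) > 0" "hnth h 0 = 0"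
  shows "hnth (htaylor h F) 0 = hnth F 0"
proof -
  obtain r where r: "CHAR('a) = Suc r"
    using assms(1) gr0_implies_Suc by blast
  show ?thesis
    unfolding htaylor_def r sum.lessThan_Suc_shift hnth_add hnth_sum
    by (simp add: assms mult.assoc hnth_one)
qed

text \<open>The Leibniz rule yields the Taylor sum of \<open>hderiv F\<close> and, after an index
  shift, \<open>hderiv h\<close> times the same sum without its last term. The hypothesis on
  \<open>h\<close> makes the missing term zero.\<close>

lemma hderiv_htaylor:
  fixes h F :: "'a::field hurwitz"
  assumes char: "CHAR('a) > 0" and h: "hderiv h * h ^ (CHAR('a) - 1) = 0"
  shows "hderiv (htaylor h F) = (1 + hderiv h) * htaylor h (hderiv F)"
proof -
  obtain r where r: "CHAR('a) = Suc r"
    using char gr0_implies_Suc by blast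
  define T where "T j = hconst (1 / of_nat (fact j)) * h ^ j * (hderiv ^^ j) (hderiv F)" for j
  have "hderiv (htaylor h F) =
    (\<Sum>j<Suc r. hconst (1 / of_nat (fact j)) * hderiv (h ^ j) * (hderiv ^^ j) F) + (\<Sum>j<Suc r. T j)"
    unfolding htaylor_def r hderiv_sum sum.distrib[symmetric] T_def
    by (intro sum.cong refl)
      (simp add: hderiv_mult mult.assoc funpow_swap1 algebra_simps)
  also have "(\<Sum>j<Suc r. hconst (1 / of_nat (fact j)) * hderiv (h ^ j) * (hderiv ^^ j) F) =
    (\<Sum>j<r. hderiv h * T j)"
  proof -
    have "hconst (1 / of_nat (fact (Suc j))) * hderiv (h ^ Suc j) * (hderiv ^^ Suc j) F = hderiv h * T j"
      if "j < r" for j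
    proof -
      \<comment> \<open>Here \<open>Suc j\<close> lies strictly between 0 and the
        characteristic.\<close>
      have "of_nat (Suc j) \<noteq> (0 :: 'a)"
        using that r by (metis Suc_mono dvd_imp_le not_less of_nat_eq_0_iff_char_dvd zero_less_Suc)
      moreover have "of_nat (fact (Suc j)) = (of_nat (Suc j) * of_nat (fact j) :: 'a)"
        by (simp only: fact_Suc of_nat_mult of_nat_id)
      ultimately have "1 / of_nat (fact (Suc j)) * of_nat (Suc j) = (1 / of_nat (fact j) :: 'a)"
        by simp
      then have f: "hconst (1 / of_nat (fact (Suc j))) * of_nat (Suc j) =
        (hconst (1 / of_nat (fact j)) :: 'a hurwitz)"
        by (simp only: of_nat_hurwitz flip: hconst_mult)
      have "hconst (1 / of_nat (fact (Suc j))) * hderiv (h ^ Suc j) * (hderiv ^^ Suc j) F =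
        hconst (1 / of_nat (fact (Suc j))) * of_nat (Suc j) *
          (h ^ j * hderiv h * (hderiv ^^ j) (hderiv F))"
        unfolding hderiv_power funpow_Suc_right o_apply by (simp only: mult.assoc)
      also have "\<dots> = hderiv h * T j"
        unfolding f T_def by (simp only: mult_ac)
      finally show ?thesis .
    qed
    then show ?thesis
      unfolding sum.lessThan_Suc_shift by simp
  qed
  also have "(\<Sum>j<r. hderiv h * T j) = hderiv h * (\<Sum>j<Suc r. T j)"
  proof -
    have "hderiv h * T r = hderiv h * h ^ r * (hconst (1 / of_nat (fact r)) * (hderiv ^^ r) (hderiv F))"
      by (simp add: T_def mult_ac)
    then have "hderiv h * T r = 0"
      using h r by simp
    then show ?thesis
      by (simp add: distrib_left sum_distrib_left)
  qed
  finally show ?thesis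
    by (simp only: htaylor_def r T_def distrib_right mult_1_left add.commute)
qed

lemma htaylor_hspace:
  fixes h F :: "'a::field hurwitz"
  assumes "CHAR('a) > 0" "h \<in> hspace n" "F \<in> hspace n"
  shows "htaylor h F \<in> hspace n"
  unfolding htaylor_def
  by (intro hspace_sum hspace_mult hspace_hconst_mult hspace_power funpow_hderiv_hspace assms)

text \<open>Each factor \<open>h\<close> raises the order by \<open>Suc s\<close>, and each
  derivative lowers it by at most one. So the terms with \<open>j \<ge> 2\<close> have order at
  least \<open>m + 2 * s\<close>, which exceeds \<open>m + s\<close>.\<close>

lemma htaylor_approx:
  fixes h F :: "'a::field hurwitz"
  assumes "CHAR('a) > 0" "hvanish (Suc s) h" "hvanish m F" "s > 0"
  shows "hvanish (Suc (m + s)) (htaylor h F - (F + h * hderiv F))"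
proof -
  have "CHAR('a) \<ge> 2"
    using prime_CHAR_semidom[OF assms(1)] by (rule prime_ge_2_nat)
  then have "{..<CHAR('a)} = {0, 1} \<union> {2..<CHAR('a)}"
    by auto
  then have "htaylor h F - (F + h * hderiv F) =
    (\<Sum>j\<in>{2..<CHAR('a)}. hconst (1 / of_nat (fact j)) * (h ^ j * (hderiv ^^ j) F))"
    unfolding htaylor_def by (simp add: sum.union_disjoint mult.assoc)
  moreover have "hvanish (Suc (m + s)) (hconst (1 / of_nat (fact j)) * (h ^ j * (hderiv ^^ j) F))"
    if "j \<ge> 2" for j
  proof (rule hvanish_hconst_mult)
    have "hvanish (j * Suc s + (m - j)) (h ^ j * (hderiv ^^ j) F)"
      by (intro hvanish_mult hvanish_power hvanish_hderiv_funpow assms)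
    moreover have "2 * s \<le> j * s"
      using that by simp
    then have "Suc (m + s) \<le> j * Suc s + (m - j)"
      unfolding mult_Suc_right using assms(4) that by linarith
    ultimately show "hvanish (Suc (m + s)) (h ^ j * (hderiv ^^ j) F)"
      by (rule hvanish_mono)
  qed
  ultimately show ?thesis
    by (auto intro: hvanish_sum)
qed

text \<open>The inverse of \<open>v\<close> is a geometric series, finite because the monomial of
  degree \<open>s\<close> has zero \<open>p\<close>-th power. That \<open>Suc s\<close> is not a
  power of \<open>p\<close> makes the obstruction to the commutation rule vanish.\<close>

lemma admissible_map_htaylor:
  fixes b :: "'a::field"
  assumes char: "CHAR('a) > 0" and s: "s > 0" "Suc s < CHAR('a) ^ n" "\<nexists>j. Suc s = CHAR('a) ^ j"
  shows "admissible_map n (htaylor (hconst b * hmonom (Suc s))) (1 + hconst b * hmonom s)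
    (\<Sum>i<CHAR('a). (- (hconst b * hmonom s)) ^ i)"
proof
  let ?p = "CHAR('a)"
  let ?h = "hconst b * hmonom (Suc s)" and ?g = "hconst b * hmonom s"
  have g: "?g \<in> hspace n" and h: "?h \<in> hspace n"
    using s by (auto intro!: hspace_hconst_mult hspace_hmonom)
  have "hderiv ?h * ?h ^ (?p - 1) =
    hconst b * hconst b ^ (?p - 1) * (hmonom s * hmonom (Suc s) ^ (?p - 1))"
    by (simp add: hderiv_hconst_mult power_mult_distrib mult_ac)
  then have "hderiv ?h * ?h ^ (?p - 1) = 0"
    using hmonom_pred_mult_power[OF char, of "Suc s"] s(3) by simp
  then show "hderiv (htaylor ?h F) = (1 + ?g) * htaylor ?h (hderiv F)" for F
    using hderiv_htaylor[OF char, of ?h F] by (simp add: hderiv_hconst_mult)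
  show "1 + ?g \<in> hspace n"
    by (intro hspace_add hspace_one char g)
  show "(\<Sum>i<?p. (- ?g) ^ i) \<in> hspace n"
    by (intro hspace_sum hspace_power hspace_uminus char g)
  have "(- ?g) ^ ?p = 0"
    unfolding power_minus[of ?g] power_mult_distrib by (simp add: hmonom_power_CHAR[OF char s(1)])
  then show "(\<Sum>i<?p. (- ?g) ^ i) * (1 + ?g) = 1"
    using one_diff_power_eq[of "- ?g" ?p] by (simp only: mult.commute diff_minus_eq_add diff_zero)
  show "htaylor ?h F \<in> hspace n" if "F \<in> hspace n" for F
    using that by (intro htaylor_hspace char h)
  show "hnth (htaylor ?h F) 0 = hnth F 0" for F
    by (intro hnth_htaylor_0 char) (simp add: hnth_hmonom)
qed (rule char htaylor_add)+

section \<open>Normalization\<close>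

lemma zass_alg_eliminate:
  fixes q :: "nat \<Rightarrow> 'a::field"
  assumes char: "CHAR('a) > 0" and q: "q \<in> dp_space n" "\<And>i. i < m \<Longrightarrow> q i = 0" "q m \<noteq> 0"
    and s: "s > 0" "m + s < CHAR('a) ^ n" "\<nexists>j. Suc s = CHAR('a) ^ j"
    and binom: "of_nat ((m + s + 1) choose m) \<noteq> (0 :: 'a)"
  obtains q' where "q' \<in> dp_space n" "zass_alg n q \<cong>\<^sub>2 zass_alg n q'"
    "\<And>k. k < m + s \<Longrightarrow> q' k = q k" "q' (m + s) = 0"
proof -
  \<comment> \<open>Chosen to solve
    \<open>q (m + s) + b * of_nat ((m + s + 1) choose m) * q m = 0\<close>.\<close>
  define b where "b = - q (m + s) / (of_nat ((m + s + 1) choose m) * q m)"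
  define h where "h = hconst b * hmonom (Suc s)"
  define Q where "Q = Hurwitz q"
  define Q' where "Q' = (1 + hderiv h) * htaylor h Q"
  have Dh: "hderiv h = hconst b * hmonom s"
    by (simp add: h_def hderiv_hconst_mult)
  \<comment> \<open>The degree bound gives only \<open>\<le>\<close>; equality would make
    \<open>Suc s\<close> a power of the characteristic.\<close>
  have "Suc s < CHAR('a) ^ n"
    using s(2) s(3)[simplified, rule_format, of n] by linarith
  then interpret admissible_map n "htaylor h" "1 + hderiv h" "\<Sum>i<CHAR('a). (- hderiv h) ^ i"
    unfolding h_def Dh[unfolded h_def] using s by (intro admissible_map_htaylor char) auto
  have Q: "Q \<in> hspace n" "hvanish m Q"
    using q by (auto simp: Q_def hspace_def hvanish_def)
  have h: "hvanish (Suc s) h" and Dh': "hvanish s (hderiv h)"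
    by (auto simp: h_def hvanish_def hnth_hmonom Dh)
  have "hvanish (0 + Suc (m + s)) ((1 + hderiv h) * (htaylor h Q - (Q + h * hderiv Q)))"
    by (intro hvanish_mult htaylor_approx char h Q s hvanish_0)
  \<comment> \<open>This term, quadratic in \<open>h\<close>, is what separates the first-order part
    of \<open>Q'\<close> from \<open>Q + hderiv (h * Q)\<close>. Its order exceeds
    \<open>m + s\<close>, also for \<open>m = 0\<close>, where \<open>m - 1\<close> is 0.\<close>
  moreover have "hvanish (s + (Suc s + (m - 1))) (hderiv h * (h * hderiv Q))"
    by (intro hvanish_mult hvanish_hderiv h Dh' Q)
  then have "hvanish (0 + Suc (m + s)) (hderiv h * (h * hderiv Q))"
    by (rule hvanish_mono) (use s in simp)
  ultimately have "hvanish (0 + Suc (m + s)) ((1 + hderiv h) * (htaylor h Q - (Q + h * hderiv Q))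
      + hderiv h * (h * hderiv Q))"
    by (rule hvanish_add)
  also have "(1 + hderiv h) * (htaylor h Q - (Q + h * hderiv Q)) + hderiv h * (h * hderiv Q) =
    Q' - (Q + hderiv (h * Q))"
    by (simp add: Q'_def hderiv_mult algebra_simps)
  finally have Q': "hnth Q' k = q k + hnth (h * Q) (Suc k)" if "k \<le> m + s" for k
    using that by (auto simp: hvanish_def Q_def less_Suc_eq_le)
  show ?thesis
  proof (rule that[of "hnth Q'"])
    show "zass_alg n q \<cong>\<^sub>2 zass_alg n (hnth Q')"
      using zass_alg_isomorphic[OF q(1)] by (simp add: Q'_def Q_def)
    have "Q' \<in> hspace n"
      unfolding Q'_def by (intro hspace_mult char v_hspace map_hspace Q)
    then show "hnth Q' \<in> dp_space n"
      by (simp add: hspace_def)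
    show "hnth Q' k = q k" if "k < m + s" for k
      using Q'[of k] that q(2) by (simp add: h_def mult.assoc hnth_hmonom_mult Q_def)
    have "(m + s + 1) choose m = (m + s + 1) choose Suc s"
      using binomial_symmetric[of m "m + s + 1"] by simp
    then show "hnth Q' (m + s) = 0"
      using Q'[of "m + s"] q(3) binom
      by (simp add: h_def mult.assoc hnth_hmonom_mult Q_def b_def)
  qed
qed

text \<open>This is the substitution of \<open>c\<close> times the variable, whose derivative
  \<open>c\<close> plays the part of \<open>v\<close>.\<close>

lemma admissible_map_scaling:
  fixes c :: "'a::field"
  assumes "CHAR('a) > 0" "c \<noteq> 0"
  shows "admissible_map n (\<lambda>F. Hurwitz (\<lambda>k. c ^ k * hnth F k)) (hconst c) (hconst (1 / c))"
proof
  show "hconst c \<in> hspace n" "hconst (1 / c) \<in> hspace n"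
    by (intro hspace_hconst assms)+
qed (use assms in \<open>auto simp: hspace_iff algebra_simps simp flip: hconst_mult
    intro!: hurwitz_eqI\<close>)

text \<open>The exponent is \<open>Suc k\<close> because \<open>v\<close> adds one factor
  \<open>c\<close> to the scaling in degree \<open>k\<close>.\<close>

lemma zass_alg_rescale:
  fixes q :: "nat \<Rightarrow> 'a::field"
  assumes "CHAR('a) > 0" "c \<noteq> 0" "q \<in> dp_space n"
  shows "zass_alg n q \<cong>\<^sub>2 zass_alg n (\<lambda>k. c ^ Suc k * q k)"
proof -
  interpret admissible_map n "\<lambda>F. Hurwitz (\<lambda>k. c ^ k * hnth F k)" "hconst c" "hconst (1 / c)"
    using assms by (intro admissible_map_scaling)
  have "hnth (hconst c * Hurwitz (\<lambda>k. c ^ k * hnth (Hurwitz q) k)) = (\<lambda>k. c ^ Suc k * q k)"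
    by (simp add: fun_eq_iff mult.assoc)
  then show ?thesis
    using zass_alg_isomorphic[OF assms(3)] by simp
qed

lemma alg_isomorphic_trans:
  assumes "A \<cong>\<^sub>2 B" "B \<cong>\<^sub>2 C"
  shows "A \<cong>\<^sub>2 C"
proof -
  obtain f where f: "bij_betw f (space A) (space B)"
    "\<forall>x\<in>space A. \<forall>y\<in>space A. f (x + y) = f x + f y"
    "\<forall>c. \<forall>x\<in>space A. f (c *\<^sub>d x) = c *\<^sub>d f x"
    "\<forall>x\<in>space A. \<forall>y\<in>space A. f (bracket A x y) = bracket B (f x) (f y)"
    "\<forall>x\<in>space A. \<forall>y\<in>space A. f (product A x y) = product B (f x) (f y)"
    using assms(1) unfolding alg_isomorphic_def by (elim exE conjE)
  obtain g where g: "bij_betw g (space B) (space C)"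
    "\<forall>x\<in>space B. \<forall>y\<in>space B. g (x + y) = g x + g y"
    "\<forall>c. \<forall>x\<in>space B. g (c *\<^sub>d x) = c *\<^sub>d g x"
    "\<forall>x\<in>space B. \<forall>y\<in>space B. g (bracket B x y) = bracket C (g x) (g y)"
    "\<forall>x\<in>space B. \<forall>y\<in>space B. g (product B x y) = product C (g x) (g y)"
    using assms(2) unfolding alg_isomorphic_def by (elim exE conjE)
  have "f x \<in> space B" if "x \<in> space A" for x
    using f(1) that by (rule bij_betw_apply)
  then show ?thesis
    unfolding alg_isomorphic_def
    using bij_betw_trans[OF f(1) g(1)] f(2-) g(2-)
    by (intro exI[of _ "g \<circ> f"] conjI ballI allI) simp_all
qed

theorem theorem4p6:
  fixes q :: "nat \<Rightarrow> 'a::alg_closed_field" and p n m :: nat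
  assumes "CHAR('a) = p" and "p > 3" and "n \<ge> 1"
    and "q \<in> dp_space n" and "q \<noteq> 0"
    and "int m = zass_nu n q + 1"
  shows "\<exists>a :: nat \<Rightarrow> 'a.
    zass_alg n q \<cong>\<^sub>2
    zass_alg n (zass_e n (zass_nu n q) +
      (\<Sum>i\<in>exc_set p n m. a i *\<^sub>d zass_e n (zass_nu n q + int i)))"
proof -
  have char: "CHAR('a) > 0"
    using assms(1,2) by simp
  let ?I = "{i \<in> {-1 .. int (p ^ n) - 2}. zass_coeff q i \<noteq> 0}"
  have nu: "zass_nu n q = Min ?I"
    by (simp add: zass_nu_def assms(1))
  \<comment> \<open>Coordinate \<open>k\<close> belongs to the basis vector with index
    \<open>k - 1\<close>.\<close>
  have mem_I: "int k - 1 \<in> ?I" if "q k \<noteq> 0" for k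
  proof -
    have "k < p ^ n"
      using that assms(1,4) not_less unfolding dp_space_def by blast
    then have "int (Suc k) \<le> int (p ^ n)"
      unfolding of_nat_le_iff by (rule Suc_leI)
    then have "int k - 1 \<in> {-1 .. int (p ^ n) - 2}"
      unfolding atLeastAtMost_iff of_nat_Suc by linarith
    then show ?thesis
      using that by (simp add: zass_coeff_def)
  qed
  obtain k where "q k \<noteq> 0"
    using assms(5) by (auto simp: fun_eq_iff)
  then have "?I \<noteq> {}"
    using mem_I by blast
  moreover have fin: "finite ?I"
    by (rule finite_subset[of _ "{-1 .. int (p ^ n) - 2}"]) auto
  ultimately have "zass_nu n q \<in> ?I"
    unfolding nu by (intro Min_in)
  then have "zass_nu n q \<le> int (p ^ n) - 2" and coeff: "zass_coeff q (zass_nu n q) \<noteq> 0"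
    unfolding mem_Collect_eq atLeastAtMost_iff by simp_all
  then have "int m < int (p ^ n)"
    using assms(6) by linarith
  then have "m < p ^ n"
    unfolding of_nat_less_iff .
  have "q m \<noteq> 0"
    using coeff unfolding zass_coeff_def assms(6)[symmetric] nat_int .
  have q_below: "q i = 0" if "i < m" for i
  proof (rule ccontr)
    assume "q i \<noteq> 0"
    then have "zass_nu n q \<le> int i - 1"
      unfolding nu by (intro Min_le[OF fin] mem_I)
    with that assms(6) show False
      by simp
  qed
  \<comment> \<open>Algebraic closedness gives the root by which rescaling turns the coefficient in
    degree \<open>m\<close> into 1.\<close>
  obtain c where c: "c ^ Suc m = 1 / q m"
    using nth_root_exists[of "Suc m" "1 / q m"] by auto
  have "c \<noteq> 0"
    using c \<open>q m \<noteq> 0\<close> by auto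
  \<comment> \<open>Degrees are cleared upwards. Clearing \<open>m + Suc t\<close> may disturb only
    higher degrees, so the earlier work and the leading coefficient survive.\<close>
  have "\<exists>q'. q' \<in> dp_space n \<and> zass_alg n q \<cong>\<^sub>2 zass_alg n q' \<and> (\<forall>i<m. q' i = 0) \<and> q' m = 1 \<and>
    (\<forall>s. 0 < s \<longrightarrow> s \<le> t \<longrightarrow> m + s < p ^ n \<longrightarrow> s \<notin> exc_set p n m \<longrightarrow> q' (m + s) = 0)" for t
  proof (induction t)
    case 0
    have "zass_alg n q \<cong>\<^sub>2 zass_alg n (\<lambda>k. c ^ Suc k * q k)"
      using char \<open>c \<noteq> 0\<close> assms(4) by (rule zass_alg_rescale)
    then show ?case
      using assms(4) c \<open>q m \<noteq> 0\<close> q_below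
      by (intro exI[of _ "\<lambda>k. c ^ Suc k * q k"]) (auto simp: dp_space_def)
  next
    case (Suc t)
    then obtain q' where q': "q' \<in> dp_space n" "zass_alg n q \<cong>\<^sub>2 zass_alg n q'"
        "\<And>i. i < m \<Longrightarrow> q' i = 0" "q' m = 1"
        "\<And>s. 0 < s \<Longrightarrow> s \<le> t \<Longrightarrow> m + s < p ^ n \<Longrightarrow> s \<notin> exc_set p n m \<Longrightarrow> q' (m + s) = 0"
      by blast
    show ?case
    proof (cases "m + Suc t < p ^ n \<and> Suc t \<notin> exc_set p n m")
      case False
      then show ?thesis
        using q' by (intro exI[of _ q']) (auto simp: le_Suc_eq)
    next
      case True
      then have "m + Suc t \<le> p ^ n - 1"
        by linarith
      with True have no_power: "\<nexists>j. Suc t = p ^ j - 1"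
        and "\<not> [(m + Suc t + 1) choose m = 0] (mod p)"
        unfolding exc_set_def by blast+
      then have binom: "of_nat ((m + Suc t + 1) choose m) \<noteq> (0 :: 'a)"
        unfolding cong_0_iff of_nat_eq_0_iff_char_dvd assms(1) by blast
      have "\<nexists>j. Suc (Suc t) = CHAR('a) ^ j"
        using no_power unfolding assms(1) by (metis diff_Suc_1)
      moreover have "m + Suc t < CHAR('a) ^ n" "q' m \<noteq> 0"
        using True q'(4) by (simp_all add: assms(1))
      ultimately obtain q'' where q'': "q'' \<in> dp_space n" "zass_alg n q' \<cong>\<^sub>2 zass_alg n q''"
          "\<And>k. k < m + Suc t \<Longrightarrow> q'' k = q' k" "q'' (m + Suc t) = 0"
        using zass_alg_eliminate[OF char q'(1) q'(3) _ zero_less_Suc _ _ binom] by blast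
      then show ?thesis
        using q' alg_isomorphic_trans[OF q'(2) q''(2)]
        by (intro exI[of _ q'']) (auto simp: le_Suc_eq)
    qed
  qed
  \<comment> \<open>The bound \<open>p ^ n\<close> covers every \<open>s\<close> with
    \<open>m + s < p ^ n\<close>.\<close>
  from this[of "p ^ n"] obtain q' where q': "q' \<in> dp_space n" "zass_alg n q \<cong>\<^sub>2 zass_alg n q'"
      "\<forall>i<m. q' i = 0" "q' m = 1"
      "\<forall>s. 0 < s \<longrightarrow> s \<le> p ^ n \<longrightarrow> m + s < p ^ n \<longrightarrow> s \<notin> exc_set p n m \<longrightarrow> q' (m + s) = 0"
    by blast
  define E where "E = exc_set p n m"
  have E: "s > 0 \<and> m + s < p ^ n" if "s \<in> E" for s
    using that \<open>m < p ^ n\<close> by (auto simp: E_def exc_set_def)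
  have "E \<subseteq> {..<p ^ n}"
    using E by (metis add_lessD1 add.commute lessThan_iff subsetI)
  then have "finite E"
    by (rule finite_subset) simp
  have nu_eq: "zass_nu n q = int m - 1"
    using assms(6) by simp
  have e: "zass_e n (zass_nu n q) = (dp_basis n m :: nat \<Rightarrow> 'a)"
    "zass_e n (zass_nu n q + int i) = (dp_basis n (m + i) :: nat \<Rightarrow> 'a)" for i
    unfolding zass_e_def nu_eq by (simp_all add: nat_int_add)
  have "q' k = (zass_e n (zass_nu n q) +
      (\<Sum>i\<in>exc_set p n m. q' (m + i) *\<^sub>d zass_e n (zass_nu n q + int i))) k" for k
  proof -
    \<comment> \<open>Only \<open>i = k - m\<close> contributes. For \<open>k < m\<close> this
      difference is 0, hence the guard \<open>m \<le> k\<close>.\<close>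
    have "(\<Sum>i\<in>E. q' (m + i) * dp_basis n (m + i) k) =
      (\<Sum>i\<in>E. if i = k - m then (if m \<le> k then q' k else 0) else 0)"
      using E assms(1) by (intro sum.cong) (auto simp: dp_basis_def)
    also have "\<dots> = (if k - m \<in> E \<and> m \<le> k then q' k else 0)"
      using \<open>finite E\<close> by simp
    finally have sum: "(\<Sum>i\<in>E. q' (m + i) * dp_basis n (m + i) k) =
      (if k - m \<in> E \<and> m \<le> k then q' k else 0)" .
    have "0 \<notin> E"
      using E by blast
    have "q' k = 0" if "m < k" "k - m \<notin> E"
    proof (cases "k < p ^ n")
      case True
      then show ?thesis
        using q'(5)[rule_format, of "k - m"] that by (simp add: E_def)
    next
      case False
      then show ?thesis
        using q'(1) assms(1) by (simp add: dp_space_def)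
    qed
    then have "q' k = dp_basis n m k + (if k - m \<in> E \<and> m \<le> k then q' k else 0)"
      using q'(3,4) \<open>0 \<notin> E\<close> \<open>m < p ^ n\<close> assms(1)
      by (cases k m rule: linorder_cases) (simp_all add: dp_basis_def)
    then show ?thesis
      by (simp only: e plus_fun_def sum_fun_apply dp_scale_def sum E_def[symmetric])
  qed
  then have "q' = zass_e n (zass_nu n q) +
      (\<Sum>i\<in>exc_set p n m. q' (m + i) *\<^sub>d zass_e n (zass_nu n q + int i))"
    by (rule ext)
  with q'(2) show ?thesis
    by (intro exI[of _ "\<lambda>i. q' (m + i)"]) simp
qed

end
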